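(* Let $X$ be a simplicial set and $Y$ a simplicial group. For every simplicial probability distribution $p\in\mathrm{sSet}(X,D(Y))$ the noncontextual fraction of $p$ equals its invertible fraction in the real convex monoid $\mathrm{sSet}(X,D(Y))$: $$\mathrm{NCF}(p)=\mathrm{IF}(p).$$
   Context: For a set $S$, $D(S)=D_{\mathbb{R}_{\ge0}}(S)$ is the set of functions $p:S\to\mathbb{R}_{\ge0}$ of finite support with $\sum_s p(s)=1$; $D(f)(p)(t)=\sum_{f(s)=t}p(s)$; $\delta^s$ is the delta distribution. For a simplicial set $Y$, $D(Y)$ is obtained by applying $D$ degreewise. The map $\Theta_{X,Y}:D(\mathrm{sSet}(X,Y))\to\mathrm{sSet}(X,D(Y))$ is $\Theta_{X,Y}(d)_n(x)=\sum_{\varphi}d(\varphi)\delta^{\varphi_n(x)}$; elements in its image are called noncontextual. $\mathrm{NCF}(p)$ is the supremum of $\alpha\in[0,1]$ such that $p=\alpha q+(1-\alpha)s$ (convex combination taken pointwise, $p_n(x)=\alpha q_n(x)+(1-\alpha)s_n(x)$) for some $q,s\in\mathrm{sSet}(X,D(Y))$ with $q$ noncontextual. $M=\mathrm{sSet}(X,D(Y))$ is a monoid under $(p\cdot q)_n(x)(y)=\sum_{y_1y_2=y}p_n(x)(y_1)q_n(x)(y_2)$ with unit $x\mapsto\delta^{e}$ ($e$ the identity of $Y_n$), and has the convex structure map $\pi:D(M)\to M$, $\pi(Q)_n(x)=\sum_{q\in M}Q(q)q_n(x)$. Let $M^*$ be the set of invertible elements of $M$. For $m\in M$, $\mathrm{IF}(m)=\sup\{\sum_{m'\in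 M^*}P(m'):P\in D(M),\ \pi(P)=m\}$. *)

theory Defs
  imports Complex_Main "HOL-Library.FuncSet" "HOL-Algebra.Group"
begin

section \<open>Simplicial sets and simplicial groups\<close>

text \<open>Morphisms \<open>[m] \<rightarrow> [n]\<close> of the simplex category, where \<open>[n]\<close> is \<open>{..n}\<close>; extensional,
  so that every monotone map is represented exactly once.\<close>

definition simplex_maps :: "nat \<Rightarrow> nat \<Rightarrow> (nat \<Rightarrow> nat) set" where
  "simplex_maps m n = {\<theta> \<in> {..m} \<rightarrow>\<^sub>E {..n}. mono_on {..m} \<theta>}"

text \<open>\<open>act X m n \<theta>\<close> is the structure map \<open>X\<^sub>n \<rightarrow> X\<^sub>m\<close> induced by \<open>\<theta> : [m] \<rightarrow> [n]\<close>; only its values on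
  \<open>X\<^sub>n\<close> are meaningful.\<close>

record 'a sset =
  simplices :: "nat \<Rightarrow> 'a set"
  act :: "nat \<Rightarrow> nat \<Rightarrow> (nat \<Rightarrow> nat) \<Rightarrow> 'a \<Rightarrow> 'a"

definition simplicial_set :: "'a sset \<Rightarrow> bool" where
  "simplicial_set X \<longleftrightarrow>
     (\<forall>m n. \<forall>\<theta>\<in>simplex_maps m n. act X m n \<theta> \<in> simplices X n \<rightarrow> simplices X m) \<and>
     (\<forall>n. \<forall>x\<in>simplices X n. act X n n (\<lambda>i\<in>{..n}. i) x = x) \<and>
     (\<forall>k m n. \<forall>\<theta>\<in>simplex_maps k m. \<forall>\<eta>\<in>simplex_maps m n. \<forall>x\<in>simplices X n.
        act X k n (compose {..k} \<eta> \<theta>) x = act X k m \<theta> (act X m n \<eta> x))"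

text \<open>The set of simplicial maps. Components are extensional, so that two maps are equal as HOL
  functions iff they agree on all simplices.\<close>

definition sSet :: "'a sset \<Rightarrow> 'b sset \<Rightarrow> (nat \<Rightarrow> 'a \<Rightarrow> 'b) set" where
  "sSet X Z = {f. (\<forall>n. f n \<in> simplices X n \<rightarrow>\<^sub>E simplices Z n) \<and>
     (\<forall>m n. \<forall>\<theta>\<in>simplex_maps m n. \<forall>x\<in>simplices X n.
        f m (act X m n \<theta> x) = act Z m n \<theta> (f n x))}"

record 'b sgroup =
  grp :: "nat \<Rightarrow> 'b monoid"
  gact :: "nat \<Rightarrow> nat \<Rightarrow> (nat \<Rightarrow> nat) \<Rightarrow> 'b \<Rightarrow> 'b"

definition underlying :: "'b sgroup \<Rightarrow> 'b sset" where
  "underlying Y = \<lparr>simplices = (\<lambda>n. carrier (grp Y n)), act = gact Y\<rparr>"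

definition simplicial_group :: "'b sgroup \<Rightarrow> bool" where
  "simplicial_group Y \<longleftrightarrow>
     simplicial_set (underlying Y) \<and>
     (\<forall>n. group (grp Y n)) \<and>
     (\<forall>m n. \<forall>\<theta>\<in>simplex_maps m n. gact Y m n \<theta> \<in> hom (grp Y n) (grp Y m))"


section \<open>Finitely supported distributions\<close>

definition supp :: "('a \<Rightarrow> real) \<Rightarrow> 'a set" where
  "supp p = {s. p s \<noteq> 0}"

text \<open>\<open>D S\<close>: a function on \<open>S\<close> is extended by zero to the ambient type.\<close>

definition D :: "'a set \<Rightarrow> ('a \<Rightarrow> real) set" where
  "D S = {p. (\<forall>s. 0 \<le> p s) \<and> supp p \<subseteq> S \<and> finite (supp p) \<and> (\<Sum>s\<in>supp p. p s) = 1}"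

definition D_map :: "('a \<Rightarrow> 'b) \<Rightarrow> ('a \<Rightarrow> real) \<Rightarrow> 'b \<Rightarrow> real" where
  "D_map f p = (\<lambda>t. \<Sum>s\<in>{s \<in> supp p. f s = t}. p s)"

definition delta :: "'a \<Rightarrow> 'a \<Rightarrow> real" where
  "delta s = (\<lambda>t. if t = s then 1 else 0)"

definition D_sset :: "'b sset \<Rightarrow> ('b \<Rightarrow> real) sset" where
  "D_sset Y = \<lparr>simplices = (\<lambda>n. D (simplices Y n)), act = (\<lambda>m n \<theta>. D_map (act Y m n \<theta>))\<rparr>"


section \<open>Noncontextual fraction\<close>

definition Theta ::
    "'a sset \<Rightarrow> 'b sset \<Rightarrow> ((nat \<Rightarrow> 'a \<Rightarrow> 'b) \<Rightarrow> real) \<Rightarrow> nat \<Rightarrow> 'a \<Rightarrow> 'b \<Rightarrow> real" where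
  "Theta X Y d = (\<lambda>n. \<lambda>x\<in>simplices X n. \<lambda>y. \<Sum>\<phi>\<in>supp d. d \<phi> * delta (\<phi> n x) y)"

definition noncontextual :: "'a sset \<Rightarrow> 'b sset \<Rightarrow> (nat \<Rightarrow> 'a \<Rightarrow> 'b \<Rightarrow> real) set" where
  "noncontextual X Y = Theta X Y ` D (sSet X Y)"

definition NCF :: "'a sset \<Rightarrow> 'b sset \<Rightarrow> (nat \<Rightarrow> 'a \<Rightarrow> 'b \<Rightarrow> real) \<Rightarrow> real" where
  "NCF X Y p = Sup {\<alpha>. 0 \<le> \<alpha> \<and> \<alpha> \<le> 1 \<and>
     (\<exists>q\<in>sSet X (D_sset Y). \<exists>s\<in>sSet X (D_sset Y). q \<in> noncontextual X Y \<and>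
        (\<forall>n. \<forall>x\<in>simplices X n. \<forall>y. p n x y = \<alpha> * q n x y + (1 - \<alpha>) * s n x y))}"


section \<open>Invertible fraction\<close>

text \<open>Data of a real convex monoid: \<open>barycenter\<close> is the convex structure map \<open>\<pi> : D(M) \<rightarrow> M\<close>.\<close>

record 'm convex_monoid = "'m monoid" +
  barycenter :: "('m \<Rightarrow> real) \<Rightarrow> 'm"

definition IF :: "'m convex_monoid \<Rightarrow> 'm \<Rightarrow> real" where
  "IF M m = Sup {(\<Sum>m'\<in>supp P \<inter> Units M. P m') | P. P \<in> D (carrier M) \<and> barycenter M P = m}"

definition convolution :: "'b monoid \<Rightarrow> ('b \<Rightarrow> real) \<Rightarrow> ('b \<Rightarrow> real) \<Rightarrow> 'b \<Rightarrow> real" where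
  "convolution G p q =
     (\<lambda>y. \<Sum>(y1, y2)\<in>{(y1, y2) \<in> supp p \<times> supp q. y1 \<otimes>\<^bsub>G\<^esub> y2 = y}. p y1 * q y2)"

definition dist_monoid :: "'a sset \<Rightarrow> 'b sgroup \<Rightarrow> (nat \<Rightarrow> 'a \<Rightarrow> 'b \<Rightarrow> real) convex_monoid" where
  "dist_monoid X Y =
     \<lparr>carrier = sSet X (D_sset (underlying Y)),
      mult = (\<lambda>p q n. \<lambda>x\<in>simplices X n. convolution (grp Y n) (p n x) (q n x)),
      one = (\<lambda>n. \<lambda>x\<in>simplices X n. delta \<one>\<^bsub>grp Y n\<^esub>),
      barycenter = (\<lambda>Q n. \<lambda>x\<in>simplices X n. \<lambda>y. \<Sum>q\<in>supp Q. Q q * q n x y)\<rparr>"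

end

theory Submission
  imports Defs
begin

text \<open>A convolution of two finitely supported distributions on a group is a point mass only if both
  factors are, since the weights are nonnegative and cannot cancel. Hence the invertible elements of
  \<open>sSet(X, D(Y))\<close> are exactly the maps \<open>x \<mapsto> \<delta>\<^bsup>\<phi>(x)\<^esup>\<close> with \<open>\<phi> \<in> sSet(X, Y)\<close>, and a
  noncontextual distribution is the same as a convex combination of invertible ones. A decomposition
  \<open>\<alpha> q + (1 - \<alpha>) s\<close> with \<open>q\<close> noncontextual becomes an element of \<open>D(M)\<close> over \<open>p\<close> of invertible weight
  at least \<open>\<alpha>\<close> (it may exceed \<open>\<alpha>\<close> when \<open>s\<close> is invertible); conversely, an element of \<open>D(M)\<close> is split
  into its invertible and its noninvertible part, each renormalised.\<close>

section \<open>Finitely supported distributions\<close>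

text \<open>Extending the sum to any finite superset of the support only adds zeros. This lets
  several distributions be summed over one common index set.\<close>

lemma D_iff:
  assumes "finite A" and "supp p \<subseteq> A"
  shows "p \<in> D S \<longleftrightarrow> (\<forall>s. 0 \<le> p s) \<and> supp p \<subseteq> S \<and> sum p A = 1"
proof -
  have "sum p (supp p) = sum p A"
    using assms by (intro sum.mono_neutral_left) (auto simp: supp_def)
  then show ?thesis
    using assms finite_subset by (auto simp: D_def)
qed

text \<open>The index set no longer depends on \<open>t\<close> or on the exact support, so such
  sums can be exchanged with others.\<close>

lemma D_map_eq_sum:
  assumes "finite A" and "supp p \<subseteq> A"
  shows "D_map f p t = (\<Sum>s\<in>A. if f s = t then p s else 0)"
proof -
  have "D_map f p t = (\<Sum>s\<in>{s \<in> A. f s = t}. p s)"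
    unfolding D_map_def using assms by (intro sum.mono_neutral_left) (auto simp: supp_def)
  then show ?thesis
    using assms(1) by (simp add: sum.inter_filter)
qed

lemma supp_delta [simp]: "supp (delta a) = {a}"
  by (auto simp: supp_def delta_def)

lemma delta_in_D: "a \<in> S \<Longrightarrow> delta a \<in> D S"
  by (simp add: D_def) (simp add: delta_def)

lemma delta_eq_iff [simp]: "delta a = delta b \<longleftrightarrow> a = b"
  using supp_delta[of a] by (metis supp_delta singleton_inject)

lemma D_map_delta [simp]: "D_map f (delta a) = delta (f a)"
proof (rule ext)
  show "D_map f (delta a) t = delta (f a) t" for t
    by (subst D_map_eq_sum[of "{a}"], simp, simp) (auto simp: delta_def)
qed

lemma supp_mixture:
  "supp (\<lambda>y. \<Sum>i\<in>I. w i * r i y) \<subseteq> (\<Union>i\<in>I. supp (r i))"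
proof -
  have "(\<Sum>i\<in>I. w i * r i y) = 0" if "\<forall>i\<in>I. r i y = 0" for y
    using that by (simp add: sum.neutral)
  then show ?thesis
    unfolding supp_def by blast
qed

lemma mixture_in_D:
  fixes w :: "'i \<Rightarrow> real"
  assumes "finite I" and "\<And>i. i \<in> I \<Longrightarrow> 0 \<le> w i" and "sum w I = 1"
    and r: "\<And>i. i \<in> I \<Longrightarrow> r i \<in> D S"
  shows "(\<lambda>y. \<Sum>i\<in>I. w i * r i y) \<in> D S"
proof -
  \<comment> \<open>A finite set carrying all components at once; exchanging the two sums over it
    reduces the total mass to that of the weights.\<close>
  let ?A = "\<Union>i\<in>I. supp (r i)"
  have A: "finite ?A" "?A \<subseteq> S"
    using assms(1) r by (auto simp: D_def)
  have "(\<Sum>y\<in>?A. \<Sum>i\<in>I. w i * r i y) = (\<Sum>i\<in>I. w i * sum (r i) ?A)"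
    by (subst sum.swap) (simp add: sum_distrib_left)
  also have "\<dots> = (\<Sum>i\<in>I. w i * 1)"
    using r D_iff[OF A(1)] by (intro sum.cong refl) (metis UN_upper)
  finally have "(\<Sum>y\<in>?A. \<Sum>i\<in>I. w i * r i y) = 1"
    using assms(3) by simp
  moreover have "0 \<le> (\<Sum>i\<in>I. w i * r i y)" for y
    using assms(2) r by (intro sum_nonneg mult_nonneg_nonneg) (auto simp: D_def)
  ultimately show ?thesis
    using A(2) supp_mixture[where I=I and w=w and r=r] unfolding D_iff[OF A(1) supp_mixture] by blast
qed

text \<open>Push-forward is linear; this gives the naturality of mixtures of simplicial
  distributions.\<close>

lemma D_map_mixture:
  assumes "finite I" and "\<And>i. i \<in> I \<Longrightarrow> finite (supp (r i))"
  shows "D_map f (\<lambda>y. \<Sum>i\<in>I. w i * r i y) = (\<lambda>t. \<Sum>i\<in>I. w i * D_map f (r i) t)"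
proof
  fix t
  let ?A = "\<Union>i\<in>I. supp (r i)"
  have A: "finite ?A"
    using assms by auto
  have "(\<Sum>i\<in>I. w i * D_map f (r i) t) = (\<Sum>i\<in>I. \<Sum>s\<in>?A. if f s = t then w i * r i s else 0)"
    using A by (intro sum.cong refl, subst D_map_eq_sum[of ?A])
      (auto simp: sum_distrib_left intro!: sum.cong)
  also have "\<dots> = (\<Sum>s\<in>?A. if f s = t then \<Sum>i\<in>I. w i * r i s else 0)"
    by (subst sum.swap) (auto intro!: sum.cong)
  also have "\<dots> = D_map f (\<lambda>y. \<Sum>i\<in>I. w i * r i y) t"
    by (rule D_map_eq_sum[OF A supp_mixture, symmetric])
  finally show "D_map f (\<lambda>y. \<Sum>i\<in>I. w i * r i y) t = (\<Sum>i\<in>I. w i * D_map f (r i) t)" ..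
qed

section \<open>Convolution on a group: point masses and factors of the unit\<close>

lemma convolution_delta: "convolution G (delta a) (delta b) = delta (a \<otimes>\<^bsub>G\<^esub> b)"
proof
  fix y
  have "{(y1, y2) \<in> {a} \<times> {b}. y1 \<otimes>\<^bsub>G\<^esub> y2 = y} = (if a \<otimes>\<^bsub>G\<^esub> b = y then {(a, b)} else {})"
    by auto
  then show "convolution G (delta a) (delta b) y = delta (a \<otimes>\<^bsub>G\<^esub> b) y"
    unfolding convolution_def supp_delta by (simp only:) (simp add: delta_def)
qed

text \<open>No cancellation is possible, so every product of a point of \<open>supp p\<close> with a
  point of \<open>supp q\<close> is the identity. With \<open>b\<close> in \<open>supp q\<close>
  fixed, all points of \<open>supp p\<close> are left inverses of \<open>b\<close>, hence
  equal.\<close>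

lemma convolution_eq_delta_one:
  assumes "group G" and p: "p \<in> D (carrier G)" and q: "q \<in> D (carrier G)"
    and eq: "convolution G p q = delta \<one>\<^bsub>G\<^esub>"
  shows "\<exists>y\<in>carrier G. p = delta y"
proof -
  interpret group G by fact
  have mult_one: "a \<otimes>\<^bsub>G\<^esub> b = \<one>\<^bsub>G\<^esub>" if ab: "a \<in> supp p" "b \<in> supp q" for a b
  proof (rule ccontr)
    assume "a \<otimes>\<^bsub>G\<^esub> b \<noteq> \<one>\<^bsub>G\<^esub>"
    let ?A = "{(y1, y2) \<in> supp p \<times> supp q. y1 \<otimes>\<^bsub>G\<^esub> y2 = a \<otimes>\<^bsub>G\<^esub> b}"
    have nonneg: "0 \<le> p y" "0 \<le> q y" for y
      using p q by (auto simp: D_def)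
    have "finite ?A"
      using p q by (auto simp: D_def intro: finite_subset[of _ "supp p \<times> supp q"])
    \<comment> \<open>The convolution vanishes away from the identity; as a sum of nonnegative terms
      it vanishes termwise, in particular at \<open>(a, b)\<close>.\<close>
    moreover have "0 = (\<Sum>(y1, y2)\<in>?A. p y1 * q y2)"
      using fun_cong[OF eq, of "a \<otimes>\<^bsub>G\<^esub> b"] \<open>a \<otimes>\<^bsub>G\<^esub> b \<noteq> \<one>\<^bsub>G\<^esub>\<close> by (simp add: convolution_def delta_def)
    moreover have "0 \<le> (case z of (y1, y2) \<Rightarrow> p y1 * q y2)" for z
      using nonneg by (simp add: case_prod_beta)
    ultimately have "\<forall>z\<in>?A. (case z of (y1, y2) \<Rightarrow> p y1 * q y2) = 0"
      by (metis (no_types, lifting) sum_nonneg_eq_0_iff)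
    then have "p a * q b = 0"
      using ab by fastforce
    then show False
      using ab by (auto simp: supp_def)
  qed
  have "supp q \<noteq> {}" "supp p \<noteq> {}"
    using p q by (auto simp: D_def)
  then obtain b where b: "b \<in> supp q" by blast
  have "b \<in> carrier G" "supp p \<subseteq> carrier G"
    using b p q by (auto simp: D_def)
  then have "supp p \<subseteq> {inv\<^bsub>G\<^esub> b}"
    using mult_one[OF _ b] inv_equality[of _ b] by fastforce
  then have supp: "supp p = {inv\<^bsub>G\<^esub> b}"
    using \<open>supp p \<noteq> {}\<close> by auto
  moreover have "p y = 0" if "y \<notin> supp p" for y
    using that by (simp add: supp_def)
  ultimately have "p = delta (inv\<^bsub>G\<^esub> b)"
    using p by (auto simp: D_def delta_def)
  then show ?thesis
    using \<open>b \<in> carrier G\<close> by blast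
qed

section \<open>Mixtures of simplicial distributions\<close>

text \<open>A common form for \<open>Theta\<close> (indexed by simplicial maps, with
  \<open>r = Delta X\<close>) and for the barycenter (indexed by elements of the monoid, with
  \<open>r\<close> the identity).\<close>

definition mixture ::
    "'a sset \<Rightarrow> 'i set \<Rightarrow> ('i \<Rightarrow> real) \<Rightarrow> ('i \<Rightarrow> nat \<Rightarrow> 'a \<Rightarrow> 'b \<Rightarrow> real) \<Rightarrow> nat \<Rightarrow> 'a \<Rightarrow> 'b \<Rightarrow> real" where
  "mixture X I w r = (\<lambda>n. \<lambda>x\<in>simplices X n. \<lambda>y. \<Sum>i\<in>I. w i * r i n x y)"

text \<open>Composition with the unit Y -> D(Y) of the distribution monad.\<close>

definition Delta :: "'a sset \<Rightarrow> (nat \<Rightarrow> 'a \<Rightarrow> 'b) \<Rightarrow> nat \<Rightarrow> 'a \<Rightarrow> 'b \<Rightarrow> real" where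
  "Delta X \<phi> = (\<lambda>n. \<lambda>x\<in>simplices X n. delta (\<phi> n x))"

lemma act_closed:
  "\<lbrakk>simplicial_set X; \<theta> \<in> simplex_maps m n; x \<in> simplices X n\<rbrakk> \<Longrightarrow> act X m n \<theta> x \<in> simplices X m"
  unfolding simplicial_set_def by blast

lemma sSet_D_component:
  "\<lbrakk>r \<in> sSet X (D_sset Y); x \<in> simplices X n\<rbrakk> \<Longrightarrow> r n x \<in> D (simplices Y n)"
  by (auto simp: sSet_def D_sset_def)

lemma sSet_extensional:
  "\<lbrakk>f \<in> sSet X Z; x \<notin> simplices X n\<rbrakk> \<Longrightarrow> f n x = undefined"
  by (auto simp: sSet_def PiE_def extensional_def)

lemma sSet_eqI:
  assumes "f \<in> sSet X Z" "g \<in> sSet X Z" "\<And>n x. x \<in> simplices X n \<Longrightarrow> f n x = g n x"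
  shows "f = g"
proof (intro ext)
  show "f n x = g n x" for n x
    using assms sSet_extensional[OF assms(1)] sSet_extensional[OF assms(2)]
    by (cases "x \<in> simplices X n") auto
qed

text \<open>Convexity holds degreewise, and naturality passes to mixtures because each
  \<open>D_map\<close> is linear.\<close>

lemma mixture_in_sSet:
  fixes w :: "'i \<Rightarrow> real"
  assumes X: "simplicial_set X" and I: "finite I"
    and w: "\<And>i. i \<in> I \<Longrightarrow> 0 \<le> w i" "sum w I = 1"
    and r: "\<And>i. i \<in> I \<Longrightarrow> r i \<in> sSet X (D_sset Y)"
  shows "mixture X I w r \<in> sSet X (D_sset Y)"
proof -
  have "mixture X I w r n x \<in> D (simplices Y n)" if "x \<in> simplices X n" for n x
    using mixture_in_D[OF I w sSet_D_component[OF r]] that by (simp add: mixture_def)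
  moreover have "mixture X I w r m (act X m n \<theta> x) = D_map (act Y m n \<theta>) (mixture X I w r n x)"
    if \<theta>: "\<theta> \<in> simplex_maps m n" and x: "x \<in> simplices X n" for m n \<theta> x
  proof -
    have "finite (supp (r i n x))" if "i \<in> I" for i
      using sSet_D_component[OF r[OF that] x] by (simp add: D_def)
    moreover have "r i m (act X m n \<theta> x) = D_map (act Y m n \<theta>) (r i n x)" if "i \<in> I" for i
      using r[OF that] \<theta> x by (auto simp: sSet_def D_sset_def)
    ultimately show ?thesis
      using act_closed[OF X \<theta> x] x I by (simp add: mixture_def D_map_mixture)
  qed
  ultimately show ?thesis
    by (auto simp: sSet_def D_sset_def mixture_def)
qed

lemma Theta_eq_mixture: "Theta X Y d = mixture X (supp d) d (Delta X)"
  by (auto simp: Theta_def mixture_def Delta_def fun_eq_iff restrict_def)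

lemma barycenter_eq_mixture: "barycenter (dist_monoid X Y) Q = mixture X (supp Q) Q (\<lambda>q. q)"
  by (simp add: dist_monoid_def mixture_def)

lemma Delta_in_sSet:
  assumes "simplicial_set X" and "\<phi> \<in> sSet X Y"
  shows "Delta X \<phi> \<in> sSet X (D_sset Y)"
  using assms act_closed[OF assms(1)] unfolding sSet_def Delta_def D_sset_def
  by (auto intro!: delta_in_D)

text \<open>A point mass determines its point. This allows sums over invertible elements to be
  reindexed by simplicial maps.\<close>

lemma inj_on_Delta: "inj_on (Delta X) (sSet X Y)"
proof (rule inj_onI)
  fix \<phi> \<psi> assume mem: "\<phi> \<in> sSet X Y" "\<psi> \<in> sSet X Y" and eq: "Delta X \<phi> = Delta X \<psi>"
  from mem show "\<phi> = \<psi>"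
  proof (rule sSet_eqI)
    fix n x assume "x \<in> simplices X n"
    then show "\<phi> n x = \<psi> n x"
      using fun_cong[OF fun_cong[OF eq, of n], of x] by (simp add: Delta_def)
  qed
qed

section \<open>Invertible elements\<close>

text \<open>Supplies a simplicial map from X to Y, and with it a noncontextual distribution,
  whatever X and Y are.\<close>

lemma one_map_in_sSet:
  assumes X: "simplicial_set X" and Y: "simplicial_group Y"
  shows "(\<lambda>n. \<lambda>x\<in>simplices X n. \<one>\<^bsub>grp Y n\<^esub>) \<in> sSet X (underlying Y)"
proof -
  have "group (grp Y n)" for n
    using Y by (simp add: simplicial_group_def)
  moreover from this have "gact Y m n \<theta> \<one>\<^bsub>grp Y n\<^esub> = \<one>\<^bsub>grp Y m\<^esub>" if "\<theta> \<in> simplex_maps m n" for m n \<theta>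
    using Y that by (intro hom_one) (simp_all add: simplicial_group_def)
  ultimately show ?thesis
    using act_closed[OF X] unfolding sSet_def underlying_def
    by (auto simp: group.is_monoid monoid.one_closed)
qed

text \<open>The structure maps of Y are group homomorphisms, so they commute with pointwise
  inversion.\<close>

lemma inverse_map_in_sSet:
  assumes X: "simplicial_set X" and Y: "simplicial_group Y" and \<phi>: "\<phi> \<in> sSet X (underlying Y)"
  shows "(\<lambda>n. \<lambda>x\<in>simplices X n. inv\<^bsub>grp Y n\<^esub> \<phi> n x) \<in> sSet X (underlying Y)"
proof -
  have G: "group (grp Y n)" for n
    using Y by (simp add: simplicial_group_def)
  have c: "\<phi> n x \<in> carrier (grp Y n)" if "x \<in> simplices X n" for n x
    using \<phi> that by (auto simp: sSet_def underlying_def)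
  have "inv\<^bsub>grp Y m\<^esub> \<phi> m (act X m n \<theta> x) = gact Y m n \<theta> (inv\<^bsub>grp Y n\<^esub> \<phi> n x)"
    if \<theta>: "\<theta> \<in> simplex_maps m n" and x: "x \<in> simplices X n" for m n \<theta> x
  proof -
    have "group_hom (grp Y n) (grp Y m) (gact Y m n \<theta>)"
      using G Y \<theta> by (simp add: simplicial_group_def group_hom_def group_hom_axioms_def)
    moreover have "\<phi> m (act X m n \<theta> x) = gact Y m n \<theta> (\<phi> n x)"
      using \<phi> \<theta> x by (auto simp: sSet_def underlying_def)
    ultimately show ?thesis
      using c[OF x] by (simp add: group_hom.hom_inv)
  qed
  then show ?thesis
    using c G act_closed[OF X] unfolding sSet_def underlying_def
    by (auto simp: group.inv_closed)
qed

lemma Units_dist_monoid: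
  fixes X :: "'a sset" and Y :: "'b sgroup"
  assumes X: "simplicial_set X" and Y: "simplicial_group Y"
  shows "Units (dist_monoid X Y) = Delta X ` sSet X (underlying Y)"
proof (intro equalityI subsetI)
  fix u assume "u \<in> Delta X ` sSet X (underlying Y)"
  then obtain \<phi> where \<phi>: "\<phi> \<in> sSet X (underlying Y)" and u: "u = Delta X \<phi>" by blast
  define \<psi> where "\<psi> = (\<lambda>n. \<lambda>x\<in>simplices X n. inv\<^bsub>grp Y n\<^esub> \<phi> n x)"
  have \<psi>: "\<psi> \<in> sSet X (underlying Y)"
    unfolding \<psi>_def by (rule inverse_map_in_sSet[OF X Y \<phi>])
  have c: "\<phi> n x \<in> carrier (grp Y n)" if "x \<in> simplices X n" for n x
    using \<phi> that by (auto simp: sSet_def underlying_def)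
  have G: "group (grp Y n)" for n
    using Y by (simp add: simplicial_group_def)
  have "Delta X \<psi> \<otimes>\<^bsub>dist_monoid X Y\<^esub> u = \<one>\<^bsub>dist_monoid X Y\<^esub>"
    "u \<otimes>\<^bsub>dist_monoid X Y\<^esub> Delta X \<psi> = \<one>\<^bsub>dist_monoid X Y\<^esub>"
    using c G unfolding u
    by (auto simp: dist_monoid_def Delta_def \<psi>_def convolution_delta group.l_inv group.r_inv
        intro!: ext restrict_ext)
  moreover have "u \<in> carrier (dist_monoid X Y)" "Delta X \<psi> \<in> carrier (dist_monoid X Y)"
    using Delta_in_sSet[OF X] \<phi> \<psi> u by (auto simp: dist_monoid_def)
  ultimately show "u \<in> Units (dist_monoid X Y)"
    unfolding Units_def by blast
next
  fix u assume "u \<in> Units (dist_monoid X Y)"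
  then obtain v where u: "u \<in> sSet X (D_sset (underlying Y))"
    and v: "v \<in> sSet X (D_sset (underlying Y))"
    and uv: "u \<otimes>\<^bsub>dist_monoid X Y\<^esub> v = \<one>\<^bsub>dist_monoid X Y\<^esub>"
    unfolding Units_def by (auto simp: dist_monoid_def)
  \<comment> \<open>The equation \<open>uv\<close> is read off at each simplex, where the group
    lemma on factors of the unit applies.\<close>
  have "\<exists>y\<in>carrier (grp Y n). u n x = delta y" if x: "x \<in> simplices X n" for n x
  proof (rule convolution_eq_delta_one)
    show "group (grp Y n)"
      using Y by (simp add: simplicial_group_def)
    show "u n x \<in> D (carrier (grp Y n))" "v n x \<in> D (carrier (grp Y n))"
      using sSet_D_component[OF u x] sSet_D_component[OF v x] by (simp_all add: underlying_def)
    show "convolution (grp Y n) (u n x) (v n x) = delta \<one>\<^bsub>grp Y n\<^esub>"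
      using fun_cong[OF fun_cong[OF uv, of n], of x] x by (simp add: dist_monoid_def)
  qed
  then have "\<forall>n x. \<exists>y. x \<in> simplices X n \<longrightarrow> y \<in> carrier (grp Y n) \<and> u n x = delta y"
    by blast
  then obtain f where f: "\<And>n x. x \<in> simplices X n \<Longrightarrow> f n x \<in> carrier (grp Y n) \<and> u n x = delta (f n x)"
    by metis
  define \<phi> where "\<phi> = (\<lambda>n. restrict (f n) (simplices X n))"
  \<comment> \<open>The pointwise choice is automatically simplicial: naturality of \<open>u\<close>
    equates two point masses, and these determine their points.\<close>
  have "f m (act X m n \<theta> x) = gact Y m n \<theta> (f n x)"
    if \<theta>: "\<theta> \<in> simplex_maps m n" and x: "x \<in> simplices X n" for m n \<theta> x
  proof -
    have "u m (act X m n \<theta> x) = D_map (gact Y m n \<theta>) (u n x)"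
      using u \<theta> x by (auto simp: sSet_def D_sset_def underlying_def)
    then show ?thesis
      using f[OF x] f[OF act_closed[OF X \<theta> x]] by simp
  qed
  then have \<phi>: "\<phi> \<in> sSet X (underlying Y)"
    using f act_closed[OF X] unfolding sSet_def underlying_def \<phi>_def by auto
  have "u = Delta X \<phi>"
    using f by (intro sSet_eqI[OF u Delta_in_sSet[OF X \<phi>]]) (simp add: Delta_def \<phi>_def)
  then show "u \<in> Delta X ` sSet X (underlying Y)"
    using \<phi> by blast
qed

section \<open>Comparison of the two fractions\<close>

text \<open>The hypothesis \<open>s\<^sub>0\<close> takes care of weights of total mass zero, which cannot be renormalised.\<close>

lemma subnormalized_mixture:
  fixes w :: "'i \<Rightarrow> real"
  assumes "simplicial_set X" and I: "finite I" and w: "\<And>i. i \<in> I \<Longrightarrow> 0 \<le> w i"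
    and "\<And>i. i \<in> I \<Longrightarrow> r i \<in> sSet X (D_sset Y)" and "s\<^sub>0 \<in> sSet X (D_sset Y)"
  shows "\<exists>s\<in>sSet X (D_sset Y). \<forall>n. \<forall>x\<in>simplices X n. \<forall>y. sum w I * s n x y = (\<Sum>i\<in>I. w i * r i n x y)"
proof (cases "sum w I = 0")
  case True
  then have "\<forall>i\<in>I. w i = 0"
    using I w by (simp add: sum_nonneg_eq_0_iff)
  then show ?thesis
    using True assms(5) by auto
next
  case False
  let ?v = "\<lambda>i. w i / sum w I"
  have "mixture X I ?v r \<in> sSet X (D_sset Y)"
    using assms False by (intro mixture_in_sSet) (auto simp: sum_nonneg sum_divide_distrib[symmetric])
  moreover have "sum w I * (\<Sum>i\<in>I. ?v i * r i n x y) = (\<Sum>i\<in>I. w i * r i n x y)" for n x y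
    using False by (simp add: sum_distrib_left)
  ultimately show ?thesis
    by (intro bexI[of _ "mixture X I ?v r"]) (auto simp: mixture_def)
qed

text \<open>The renormalisation is done on weights over simplicial maps, so that the result stays in
  the image of \<open>Theta\<close>; \<open>\<phi>\<^sub>0\<close> is the default for total mass
  zero.\<close>

lemma subnormalized_noncontextual:
  assumes "simplicial_set X" and V: "finite V" "V \<subseteq> sSet X Y" and w: "\<And>\<phi>. \<phi> \<in> V \<Longrightarrow> 0 \<le> w \<phi>"
    and "\<phi>\<^sub>0 \<in> sSet X Y"
  shows "\<exists>q\<in>noncontextual X Y. \<forall>n. \<forall>x\<in>simplices X n. \<forall>y.
    sum w V * q n x y = (\<Sum>\<phi>\<in>V. w \<phi> * Delta X \<phi> n x y)"
proof (cases "sum w V = 0")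
  case True
  then have "\<forall>\<phi>\<in>V. w \<phi> = 0"
    using V w by (simp add: sum_nonneg_eq_0_iff)
  moreover have "Theta X Y (delta \<phi>\<^sub>0) \<in> noncontextual X Y"
    using delta_in_D[OF assms(5)] by (simp add: noncontextual_def)
  ultimately show ?thesis
    using True by auto
next
  case False
  \<comment> \<open>Cut off outside \<open>V\<close>, since an element of \<open>D\<close> must have
    its support in the given set while \<open>w\<close> is arbitrary off \<open>V\<close>.\<close>
  define d where "d = (\<lambda>\<phi>. if \<phi> \<in> V then w \<phi> / sum w V else 0)"
  have supp: "supp d \<subseteq> V"
    by (auto simp: supp_def d_def split: if_splits)
  have "sum d V = 1"
    using False by (simp add: d_def sum_divide_distrib[symmetric])
  then have "d \<in> D (sSet X Y)"
    using D_iff[OF V(1) supp] supp V w by (auto simp: d_def sum_nonneg)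
  then have "Theta X Y d \<in> noncontextual X Y"
    by (simp add: noncontextual_def)
  moreover have "sum w V * Theta X Y d n x y = (\<Sum>\<phi>\<in>V. w \<phi> * Delta X \<phi> n x y)"
    if "x \<in> simplices X n" for n x y
  proof -
    have "Theta X Y d n x y = (\<Sum>\<phi>\<in>V. d \<phi> * Delta X \<phi> n x y)"
      using that V supp by (auto simp: Theta_eq_mixture mixture_def supp_def intro!: sum.mono_neutral_left)
    then show ?thesis
      using False by (simp add: d_def sum_distrib_left)
  qed
  ultimately show ?thesis by blast
qed

lemma noncontextual_subset_sSet:
  assumes "simplicial_set X"
  shows "noncontextual X Y \<subseteq> sSet X (D_sset Y)"
  unfolding noncontextual_def Theta_eq_mixture
  using assms by (auto simp: D_def intro!: mixture_in_sSet Delta_in_sSet)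

text \<open>The invertible weight itself, not merely a bound for it, is an admissible coefficient
  for the noncontextual fraction.\<close>

lemma invertible_weight_decomposition:
  assumes X: "simplicial_set X" and Y: "simplicial_group Y"
    and P: "P \<in> D (carrier (dist_monoid X Y))"
    and \<alpha>: "\<alpha> = (\<Sum>m\<in>supp P \<inter> Units (dist_monoid X Y). P m)"
  shows "0 \<le> \<alpha> \<and> \<alpha> \<le> 1 \<and> (\<exists>q\<in>sSet X (D_sset (underlying Y)). \<exists>s\<in>sSet X (D_sset (underlying Y)).
    q \<in> noncontextual X (underlying Y) \<and> (\<forall>n. \<forall>x\<in>simplices X n. \<forall>y.
      barycenter (dist_monoid X Y) P n x y = \<alpha> * q n x y + (1 - \<alpha>) * s n x y))"
proof -
  let ?U = "Units (dist_monoid X Y)" and ?S = "sSet X (underlying Y)"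
  let ?M = "sSet X (D_sset (underlying Y))"
  have P0: "0 \<le> P m" for m
    using P by (simp add: D_def)
  have fin: "finite (supp P)" and sub: "supp P \<subseteq> ?M" and total: "sum P (supp P) = 1"
    using P by (auto simp: D_def dist_monoid_def)
  \<comment> \<open>The simplicial maps that parametrise the invertible part of
    \<open>P\<close>.\<close>
  define V where "V = {\<phi> \<in> ?S. Delta X \<phi> \<in> supp P}"
  have inj: "inj_on (Delta X) V"
    by (rule inj_on_subset[OF inj_on_Delta]) (auto simp: V_def)
  have VU: "supp P \<inter> ?U = Delta X ` V"
    unfolding Units_dist_monoid[OF X Y] V_def by auto
  then have finV: "finite V"
    using fin inj finite_imageD by (metis finite_Int)
  have split: "sum g (supp P) = sum g (supp P \<inter> ?U) + sum g (supp P - ?U)"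
    for g :: "_ \<Rightarrow> real"
    by (rule sum.Int_Diff[OF fin])
  have \<alpha>V: "\<alpha> = (\<Sum>\<phi>\<in>V. P (Delta X \<phi>))"
    unfolding \<alpha> VU using inj by (simp add: sum.reindex)
  have rest: "sum P (supp P - ?U) = 1 - \<alpha>"
    using split[of P] total \<alpha> by simp
  have "0 \<le> \<alpha>" "\<alpha> \<le> 1"
    using P0 rest sum_nonneg[of "supp P - ?U" P] sum_nonneg[of V "\<lambda>\<phi>. P (Delta X \<phi>)"] \<alpha>V by simp_all
  \<comment> \<open>If \<alpha> = 0, the constant map at the identity serves as default.\<close>
  moreover obtain q where q: "q \<in> noncontextual X (underlying Y)"
    and q_eq: "\<And>n x y. x \<in> simplices X n \<Longrightarrow>
      \<alpha> * q n x y = (\<Sum>\<phi>\<in>V. P (Delta X \<phi>) * Delta X \<phi> n x y)"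
    using subnormalized_noncontextual[OF X finV, of "underlying Y" "\<lambda>\<phi>. P (Delta X \<phi>)"]
      one_map_in_sSet[OF X Y] P0 unfolding \<alpha>V V_def by blast
  moreover have qM: "q \<in> ?M"
    using q noncontextual_subset_sSet[OF X] by blast
  \<comment> \<open>The noninvertible part has mass 1 - \<alpha>; if that is zero, \<open>q\<close>
    is the default for \<open>s\<close>.\<close>
  moreover obtain s where "s \<in> ?M" and s_eq: "\<And>n x y. x \<in> simplices X n \<Longrightarrow>
      (1 - \<alpha>) * s n x y = (\<Sum>m\<in>supp P - ?U. P m * m n x y)"
    using subnormalized_mixture[OF X, of "supp P - ?U" P "\<lambda>m. m" "underlying Y" q] fin sub P0 qM
    unfolding rest by blast
  moreover have "barycenter (dist_monoid X Y) P n x y = \<alpha> * q n x y + (1 - \<alpha>) * s n x y"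
    if x: "x \<in> simplices X n" for n x y
  proof -
    have "(\<Sum>m\<in>supp P \<inter> ?U. P m * m n x y) = \<alpha> * q n x y"
      unfolding VU using inj q_eq[OF x] by (simp add: sum.reindex)
    then show ?thesis
      using x split[of "\<lambda>m. P m * m n x y"] s_eq[OF x] by (simp add: barycenter_eq_mixture mixture_def)
  qed
  ultimately show ?thesis by blast
qed

text \<open>The witness puts weight \<alpha> on the push-forward of \<open>d\<close> along
  \<open>Delta X\<close>, which lives on invertible elements, and the remaining weight on the point
  \<open>s\<close>.\<close>

lemma invertible_weight_ge:
  fixes X :: "'a sset" and Y :: "'b sgroup"
  assumes X: "simplicial_set X" and Y: "simplicial_group Y"
    and p: "p \<in> sSet X (D_sset (underlying Y))" and s: "s \<in> sSet X (D_sset (underlying Y))"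
    and q: "q \<in> noncontextual X (underlying Y)" and \<alpha>: "0 \<le> \<alpha>" "\<alpha> \<le> 1"
    and eq: "\<And>n x y. x \<in> simplices X n \<Longrightarrow> p n x y = \<alpha> * q n x y + (1 - \<alpha>) * s n x y"
  shows "\<exists>P\<in>D (carrier (dist_monoid X Y)). barycenter (dist_monoid X Y) P = p \<and>
    \<alpha> \<le> (\<Sum>m\<in>supp P \<inter> Units (dist_monoid X Y). P m)"
proof -
  let ?U = "Units (dist_monoid X Y)" and ?M = "sSet X (D_sset (underlying Y))"
  obtain d where d: "d \<in> D (sSet X (underlying Y))" and q_eq: "q = Theta X (underlying Y) d"
    using q unfolding noncontextual_def by blast
  have d0: "0 \<le> d \<phi>" for \<phi>
    using d by (simp add: D_def)
  have fin: "finite (supp d)" and sub: "supp d \<subseteq> sSet X (underlying Y)" and total: "sum d (supp d) = 1"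
    using d by (auto simp: D_def)
  have inj: "inj_on (Delta X) (supp d)"
    by (rule inj_on_subset[OF inj_on_Delta sub])
  define A where "A = Delta X ` supp d"
  \<comment> \<open>The push-forward of \<open>d\<close> along \<open>Delta X\<close>, written as a
    mixture of point masses.\<close>
  define e where "e = (\<lambda>m. \<Sum>\<phi>\<in>supp d. d \<phi> * delta (Delta X \<phi>) m)"
  define P where "P = (\<lambda>m. \<alpha> * e m + (1 - \<alpha>) * delta s m)"
  have AU: "A \<subseteq> ?U"
    unfolding A_def Units_dist_monoid[OF X Y] using sub by blast
  have AM: "A \<subseteq> ?M"
    unfolding A_def using sub Delta_in_sSet[OF X] by blast
  have finA: "finite A"
    unfolding A_def using fin by simp
  have e0: "0 \<le> e m" for m
    unfolding e_def using d0 by (auto intro!: sum_nonneg simp: delta_def)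
  have P0: "0 \<le> P m" for m
    unfolding P_def using \<alpha> e0 by (simp add: delta_def)
  have e_out: "e m = 0" if "m \<notin> A" for m
    unfolding e_def using that by (auto simp: A_def delta_def intro!: sum.neutral)
  \<comment> \<open>Change of variables: integrating \<open>g\<close> against \<open>e\<close> is
    integrating its composite with \<open>Delta X\<close> against \<open>d\<close>.\<close>
  have sum_e: "(\<Sum>m\<in>B. e m * g m) = (\<Sum>\<phi>\<in>supp d. d \<phi> * g (Delta X \<phi>))"
    if "finite B" "A \<subseteq> B" for B and g :: "_ \<Rightarrow> real"
  proof -
    have "(\<Sum>m\<in>B. e m * g m) = (\<Sum>\<phi>\<in>supp d. d \<phi> * (\<Sum>m\<in>B. delta (Delta X \<phi>) m * g m))"
      unfolding e_def sum_distrib_left sum_distrib_right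
      by (subst sum.swap) (simp add: mult.assoc)
    also have "\<dots> = (\<Sum>\<phi>\<in>supp d. d \<phi> * g (Delta X \<phi>))"
      using that by (intro sum.cong refl arg_cong2[where f="(*)"])
        (auto simp: delta_def A_def if_distrib[of "\<lambda>c. c * _"] cong: if_cong)
    finally show ?thesis .
  qed
  have supp: "supp P \<subseteq> insert s A"
    using e_out by (auto simp: supp_def P_def delta_def split: if_splits)
  \<comment> \<open>Used with \<open>g\<close> constant 1 for the total mass and with
    \<open>g\<close> evaluation at a simplex and an outcome for the barycenter. Since
    \<open>s\<close> may lie in \<open>A\<close>, the sum runs over \<open>insert s A\<close> and
    not over two separate pieces.\<close>
  have sum_P: "(\<Sum>m\<in>supp P. P m * g m) = \<alpha> * (\<Sum>\<phi>\<in>supp d. d \<phi> * g (Delta X \<phi>)) + (1 - \<alpha>) * g s"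
    for g :: "_ \<Rightarrow> real"
  proof -
    have "(\<Sum>m\<in>supp P. P m * g m) = (\<Sum>m\<in>insert s A. P m * g m)"
      using supp finA by (intro sum.mono_neutral_left) (auto simp: supp_def)
    also have "\<dots> = \<alpha> * (\<Sum>m\<in>insert s A. e m * g m) + (1 - \<alpha>) * (\<Sum>m\<in>insert s A. delta s m * g m)"
      by (simp add: P_def algebra_simps sum.distrib sum_distrib_left sum_subtractf)
    also have "(\<Sum>m\<in>insert s A. delta s m * g m) = g s"
      using finA by (simp add: delta_def if_distrib[of "\<lambda>c. c * _"] cong: if_cong)
    finally show ?thesis
      using sum_e[of "insert s A" g] finA by auto
  qed
  have "sum P (supp P) = 1"
    using sum_P[of "\<lambda>_. 1"] total by simp
  then have PD: "P \<in> D (carrier (dist_monoid X Y))"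
    using P0 supp AM s finA unfolding D_def dist_monoid_def by (auto intro: finite_subset)
  then have "barycenter (dist_monoid X Y) P \<in> ?M"
    unfolding barycenter_eq_mixture
    by (intro mixture_in_sSet[OF X]) (auto simp: D_def dist_monoid_def)
  then have "barycenter (dist_monoid X Y) P = p"
  proof (rule sSet_eqI[OF _ p])
    fix n x assume x: "x \<in> simplices X n"
    show "barycenter (dist_monoid X Y) P n x = p n x"
      using x sum_P[of "\<lambda>m. m n x _"] eq[OF x]
      by (auto simp: barycenter_eq_mixture mixture_def q_eq Theta_eq_mixture)
  qed
  moreover have "\<alpha> \<le> (\<Sum>m\<in>supp P \<inter> ?U. P m)"
  proof -
    have "\<alpha> = \<alpha> * sum e A"
      using sum_e[of A "\<lambda>_. 1"] finA total by simp
    \<comment> \<open>On \<open>A\<close> the term from \<open>s\<close> contributes at least zero;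
      it is positive only if \<open>s\<close> lies in \<open>A\<close>.\<close>
    also have "\<dots> \<le> sum P A"
      unfolding sum_distrib_left P_def using \<alpha> by (intro sum_mono) (simp add: delta_def)
    also have "\<dots> = sum P (supp P \<inter> A)"
      using finA by (intro sum.mono_neutral_right) (auto simp: supp_def)
    also have "\<dots> \<le> (\<Sum>m\<in>supp P \<inter> ?U. P m)"
      using AU P0 PD by (intro sum_mono2) (auto simp: D_def)
    finally show ?thesis .
  qed
  ultimately show ?thesis
    using PD by blast
qed

theorem corollary5p9:
  fixes X :: "'a sset" and Y :: "'b sgroup" and p :: "nat \<Rightarrow> 'a \<Rightarrow> 'b \<Rightarrow> real"
  assumes "simplicial_set X"
    and "simplicial_group Y"
    and "p \<in> sSet X (D_sset (underlying Y))"
  shows "NCF X (underlying Y) p = IF (dist_monoid X Y) p"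
proof -
  let ?M = "sSet X (D_sset (underlying Y))"
  define N where "N = {\<alpha>. 0 \<le> \<alpha> \<and> \<alpha> \<le> 1 \<and> (\<exists>q\<in>?M. \<exists>s\<in>?M. q \<in> noncontextual X (underlying Y) \<and>
    (\<forall>n. \<forall>x\<in>simplices X n. \<forall>y. p n x y = \<alpha> * q n x y + (1 - \<alpha>) * s n x y))}"
  define W where "W = {(\<Sum>m\<in>supp P \<inter> Units (dist_monoid X Y). P m) | P.
    P \<in> D (carrier (dist_monoid X Y)) \<and> barycenter (dist_monoid X Y) P = p}"
  \<comment> \<open>The two sets need not be equal: \<open>W\<close> is included in \<open>N\<close>
    and cofinal in it, which suffices for equal suprema.\<close>
  have "W \<subseteq> N"
    unfolding W_def N_def using invertible_weight_decomposition[OF assms(1,2)] by blast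
  have le: "\<exists>\<beta>\<in>W. \<alpha> \<le> \<beta>" if \<alpha>: "\<alpha> \<in> N" for \<alpha>
  proof -
    obtain q s where "s \<in> ?M" "q \<in> noncontextual X (underlying Y)" "0 \<le> \<alpha>" "\<alpha> \<le> 1"
      "\<And>n x y. x \<in> simplices X n \<Longrightarrow> p n x y = \<alpha> * q n x y + (1 - \<alpha>) * s n x y"
      using \<alpha> unfolding N_def by blast
    from invertible_weight_ge[OF assms this] show ?thesis
      unfolding W_def by blast
  qed
  obtain q where q: "q \<in> noncontextual X (underlying Y)"
    using delta_in_D[OF one_map_in_sSet[OF assms(1,2)]] unfolding noncontextual_def by blast
  \<comment> \<open>With coefficient 0 and \<open>s = p\<close> any noncontextual \<open>q\<close>
    will do. Nonemptiness and the bound 1 make the real suprema meaningful.\<close>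
  then have "0 \<in> N"
    using noncontextual_subset_sSet[OF assms(1)] assms(3) unfolding N_def by auto
  then have "W \<noteq> {}"
    using le by blast
  have "bdd_above N"
    by (rule bdd_aboveI[of _ 1]) (simp add: N_def)
  have "Sup N = Sup W"
  proof (rule antisym)
    show "Sup N \<le> Sup W"
      using \<open>0 \<in> N\<close> le bdd_above_mono[OF \<open>bdd_above N\<close> \<open>W \<subseteq> N\<close>] by (intro cSup_mono) auto
    show "Sup W \<le> Sup N"
      using \<open>W \<noteq> {}\<close> \<open>bdd_above N\<close> \<open>W \<subseteq> N\<close> by (rule cSup_subset_mono)
  qed
  then show ?thesis
    by (simp only: NCF_def IF_def N_def W_def)
qed

end
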